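(* Let $\mathbf P=(P,\le,0,1,+,\cdot)$ be an ordered semiring that is either cancellative and difference ordered, or idempotent. If $\mathbf P$ is $\omega$-continuous, then every unguarded system has a least solution; that is, for every finite set $X$, every poset $(Y,\le)$, and every $\gamma:(X,=)\to\bar{\mathcal S}_{\mathbf P}((X,=)+(Y,\le))$, there is a solution $\gamma^\dagger:(X,=)\to\bar{\mathcal S}_{\mathbf P}(Y,\le)$ of $\gamma$ such that $\gamma^\dagger(x)\sqsubseteq\psi(x)$ for all $x\in X$ and every solution $\psi:(X,=)\to\bar{\mathcal S}_{\mathbf P}(Y,\le)$ of $\gamma$.
   Context: A semiring $(P,0,1,+,\cdot)$ is a set with $(P,0,+)$ a commutative monoid, $(P,1,\cdot)$ a monoid, $0r=r0=0$, $r(s+t)=rs+rt$ and $(s+t)r=sr+tr$. An ordered semiring $\mathbf P=(P,\le,0,1,+,\cdot)$ is a semiring with a partial order $\le$ on $P$ having $0$ as bottom element and such that $+$ and $\cdot$ are monotone. It is *cancellative* if for all $r,s,t$, $r+s\le r+t$ implies $s\le t$; *difference ordered* if $r\le s$ implies that there is $t$ with $r+t=s$; *idempotent* if $r+r=r$ for all $r$; *$\omega$-continuous* if every chain $r_1\le r_2\le\cdots$ in $P$ has a least upper bound and the operations $+$ and $\cdot$ preserve least upper bounds of such chains. For a poset $(Z,\le)$, $\mathcal O_{\mathbf P}Z$ is the set of finitely supported functions $\theta:Z\to P$, and $\mathcal S_{\mathbf P}Z=\{\theta\in\mathcal O_{\mathbf P}Z:\sum_{z}\theta(z)\le1\}$.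 The heavier-higher preorder on $\mathcal O_{\mathbf P}Z$ is: $\theta_1\sqsubseteq\theta_2$ iff $\sum_{z\in U}\theta_1(z)\le\sum_{z\in U}\theta_2(z)$ for every upwards-closed $U\subseteq Z$ (i.e. $z\in U$, $z\le w$ imply $w\in U$). Write $\theta_1\equiv\theta_2$ iff $\theta_1\sqsubseteq\theta_2\sqsubseteq\theta_1$, $[\theta]$ for the $\equiv$-class, and $\bar{\mathcal S}_{\mathbf P}(Z,\le)=(\mathcal S_{\mathbf P}Z/{\equiv},\sqsubseteq)$. Addition and scalar multiplication are pointwise on $\mathcal O_{\mathbf P}Z$ and descend to $\equiv$-classes. $(X,=)$ is $X$ with the discrete order and $+$ between posets is disjoint union (coproduct). Given $\gamma:(X,=)\to\bar{\mathcal S}_{\mathbf P}((X,=)+(Y,\le))$ with $X=\{x_1,\dots,x_n\}$, pick a representative $\gamma_i$ of $\gamma(x_i)$ and put $a_{ij}=\gamma_i(x_j)$ and $\theta_i=\gamma_i|_Y$; the elements $a_{ij}$ and the classes $[\theta_i]$ do not depend on the choice of representatives. A *solution* of $\gamma$ is a map $\psi:X\to\bar{\mathcal S}_{\mathbf P}(Y,\le)$ such that $\psi(x_i)=a_{i1}\psi(x_1)+\cdots+a_{in}\psi(x_n)+[\theta_i]$ in $\mathcal O_{\mathbf P}Y/{\equiv}$ for every $i\le n$. *)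

theory Defs
  imports "HOL-Library.Poly_Mapping" "HOL-Library.Lub_Glb" "HOL-Library.FuncSet"
begin

section \<open>Ordered semirings\<close>

text \<open>
  Multiplication need not be commutative and 0 = 1 is allowed, so the class builds on
  \<^class>\<open>semiring_0\<close> and \<^class>\<open>monoid_mult\<close> rather than on \<^class>\<open>semiring_1\<close>. Since 0 is the bottom
  element, the side conditions of the monotonicity axioms of \<^class>\<open>ordered_semiring\<close> are void.
\<close>

class bot_ordered_semiring = ordered_semiring_0 + monoid_mult +
  assumes zero_bot: "0 \<le> a"

definition cancellative :: "'p::bot_ordered_semiring itself \<Rightarrow> bool" where
  "cancellative _ \<longleftrightarrow> (\<forall>r s t :: 'p. r + s \<le> r + t \<longrightarrow> s \<le> t)"

definition difference_ordered :: "'p::bot_ordered_semiring itself \<Rightarrow> bool" where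
  "difference_ordered _ \<longleftrightarrow> (\<forall>r s :: 'p. r \<le> s \<longrightarrow> (\<exists>t. r + t = s))"

definition add_idempotent :: "'p::bot_ordered_semiring itself \<Rightarrow> bool" where
  "add_idempotent _ \<longleftrightarrow> (\<forall>r :: 'p. r + r = r)"

text \<open>
  Preservation is stated jointly in both arguments; constant chains give preservation in each
  argument separately.
\<close>

definition omega_continuous :: "'p::bot_ordered_semiring itself \<Rightarrow> bool" where
  "omega_continuous _ \<longleftrightarrow>
     (\<forall>r :: nat \<Rightarrow> 'p. mono r \<longrightarrow> (\<exists>a. isLub UNIV (range r) a)) \<and>
     (\<forall>(r :: nat \<Rightarrow> 'p) s a b.
        mono r \<and> mono s \<and> isLub UNIV (range r) a \<and> isLub UNIV (range s) b \<longrightarrow>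
        isLub UNIV (range (\<lambda>n. r n + s n)) (a + b) \<and>
        isLub UNIV (range (\<lambda>n. r n * s n)) (a * b))"


section \<open>The heavier-higher order\<close>

text \<open>
  A poset is a carrier \<open>Z\<close> together with a relation \<open>le\<close> such that \<^term>\<open>partial_order_on Z le\<close>.
  A finitely supported function on \<open>Z\<close> is a \<^type>\<open>poly_mapping\<close> with support contained in \<open>Z\<close>.
\<close>

definition upclosed :: "'z set \<Rightarrow> 'z rel \<Rightarrow> 'z set \<Rightarrow> bool" where
  "upclosed Z le U \<longleftrightarrow> U \<subseteq> Z \<and> (\<forall>z\<in>U. \<forall>w. (z, w) \<in> le \<longrightarrow> w \<in> U)"

text \<open>The set \<open>U\<close> may be infinite, hence the restriction of the sum to the support.\<close>

definition weight :: "('z \<Rightarrow>\<^sub>0 'p::comm_monoid_add) \<Rightarrow> 'z set \<Rightarrow> 'p" where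
  "weight \<theta> U = (\<Sum>z \<in> U \<inter> Poly_Mapping.keys \<theta>. Poly_Mapping.lookup \<theta> z)"

definition OP :: "'z set \<Rightarrow> ('z \<Rightarrow>\<^sub>0 'p::bot_ordered_semiring) set" where
  "OP Z = {\<theta>. Poly_Mapping.keys \<theta> \<subseteq> Z}"

definition SP :: "'z set \<Rightarrow> ('z \<Rightarrow>\<^sub>0 'p::bot_ordered_semiring) set" where
  "SP Z = {\<theta> \<in> OP Z. weight \<theta> Z \<le> 1}"

definition hh_le :: "'z set \<Rightarrow> 'z rel \<Rightarrow> ('z \<Rightarrow>\<^sub>0 'p::bot_ordered_semiring) rel" where
  "hh_le Z le = {(\<theta>, \<eta>) \<in> OP Z \<times> OP Z. \<forall>U. upclosed Z le U \<longrightarrow> weight \<theta> U \<le> weight \<eta> U}"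

definition hh_eq :: "'z set \<Rightarrow> 'z rel \<Rightarrow> ('z \<Rightarrow>\<^sub>0 'p::bot_ordered_semiring) rel" where
  "hh_eq Z le = hh_le Z le \<inter> (hh_le Z le)\<inverse>"

text \<open>
  The class of an element of \<^term>\<open>SP Z\<close> in \<^term>\<open>OP Z\<close> lies in \<^term>\<open>SP Z\<close>, because \<open>Z\<close> itself is
  upwards closed; so the following is the quotient of \<^term>\<open>SP Z\<close>, and it is a subset of
  \<open>OP Z // hh_eq Z le\<close>.
\<close>

definition SPbar :: "'z set \<Rightarrow> 'z rel \<Rightarrow> ('z \<Rightarrow>\<^sub>0 'p::bot_ordered_semiring) set set" where
  "SPbar Z le = SP Z // hh_eq Z le"

definition class_le ::
  "'z set \<Rightarrow> 'z rel \<Rightarrow> ('z \<Rightarrow>\<^sub>0 'p::bot_ordered_semiring) set \<Rightarrow> ('z \<Rightarrow>\<^sub>0 'p) set \<Rightarrow> bool" where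
  "class_le Z le A B \<longleftrightarrow> (\<exists>\<theta>\<in>A. \<exists>\<eta>\<in>B. (\<theta>, \<eta>) \<in> hh_le Z le)"


section \<open>Operations on classes\<close>

definition scale :: "'p::bot_ordered_semiring \<Rightarrow> ('z \<Rightarrow>\<^sub>0 'p) \<Rightarrow> ('z \<Rightarrow>\<^sub>0 'p)" where
  "scale c \<theta> = Poly_Mapping.map (\<lambda>p. c * p) \<theta>"

definition class_scale ::
  "'z set \<Rightarrow> 'z rel \<Rightarrow> 'p::bot_ordered_semiring \<Rightarrow> ('z \<Rightarrow>\<^sub>0 'p) set \<Rightarrow> ('z \<Rightarrow>\<^sub>0 'p) set" where
  "class_scale Z le c A = (\<Union>\<theta>\<in>A. hh_eq Z le `` {scale c \<theta>})"

definition class_add ::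
  "'z set \<Rightarrow> 'z rel \<Rightarrow> ('z \<Rightarrow>\<^sub>0 'p::bot_ordered_semiring) set \<Rightarrow> ('z \<Rightarrow>\<^sub>0 'p) set
     \<Rightarrow> ('z \<Rightarrow>\<^sub>0 'p) set" where
  "class_add Z le A B = (\<Union>\<theta>\<in>A. \<Union>\<eta>\<in>B. hh_eq Z le `` {\<theta> + \<eta>})"

definition class_sum ::
  "'z set \<Rightarrow> 'z rel \<Rightarrow> ('x \<Rightarrow> ('z \<Rightarrow>\<^sub>0 'p::bot_ordered_semiring) set) \<Rightarrow> 'x set
     \<Rightarrow> ('z \<Rightarrow>\<^sub>0 'p) set" where
  "class_sum Z le A X = (\<Union>\<theta> \<in> Pi X A. hh_eq Z le `` {\<Sum>x\<in>X. \<theta> x})"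


section \<open>Unguarded systems and their solutions\<close>

definition sum_le :: "'x rel \<Rightarrow> 'y rel \<Rightarrow> ('x + 'y) rel" where
  "sum_le r s = map_prod Inl Inl ` r \<union> map_prod Inr Inr ` s"

definition unguarded_system ::
  "'x set \<Rightarrow> 'y set \<Rightarrow> 'y rel \<Rightarrow> ('x \<Rightarrow> ('x + 'y \<Rightarrow>\<^sub>0 'p::bot_ordered_semiring) set) \<Rightarrow> bool" where
  "unguarded_system X Y le \<gamma> \<longleftrightarrow> \<gamma> \<in> X \<rightarrow> SPbar (X <+> Y) (sum_le (Id_on X) le)"

definition rep :: "'a set \<Rightarrow> 'a" where
  "rep A = (SOME a. a \<in> A)"

definition coeff :: "('x \<Rightarrow> ('x + 'y \<Rightarrow>\<^sub>0 'p::bot_ordered_semiring) set) \<Rightarrow> 'x \<Rightarrow> 'x \<Rightarrow> 'p" where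
  "coeff \<gamma> x x' = Poly_Mapping.lookup (rep (\<gamma> x)) (Inl x')"

definition out_part :: "('x \<Rightarrow> ('x + 'y \<Rightarrow>\<^sub>0 'p::bot_ordered_semiring) set) \<Rightarrow> 'x \<Rightarrow> ('y \<Rightarrow>\<^sub>0 'p)" where
  "out_part \<gamma> x = Poly_Mapping.map_key Inr (rep (\<gamma> x))"

definition solution ::
  "'x set \<Rightarrow> 'y set \<Rightarrow> 'y rel \<Rightarrow> ('x \<Rightarrow> ('x + 'y \<Rightarrow>\<^sub>0 'p::bot_ordered_semiring) set)
     \<Rightarrow> ('x \<Rightarrow> ('y \<Rightarrow>\<^sub>0 'p) set) \<Rightarrow> bool" where
  "solution X Y le \<gamma> \<psi> \<longleftrightarrow>
     \<psi> \<in> X \<rightarrow> SPbar Y le \<and>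
     (\<forall>x\<in>X. \<psi> x =
        class_add Y le
          (class_sum Y le (\<lambda>x'. class_scale Y le (coeff \<gamma> x x') (\<psi> x')) X)
          (hh_eq Y le `` {out_part \<gamma> x}))"


section \<open>Well-definedness\<close>

lemma lookup_scale [simp]: "Poly_Mapping.lookup (scale c \<theta>) z = c * Poly_Mapping.lookup \<theta> z"
  by (simp add: scale_def map.rep_eq when_def)

lemma lookup_out_part:
  "Poly_Mapping.lookup (out_part \<gamma> x) y = Poly_Mapping.lookup (rep (\<gamma> x)) (Inr y)"
  by (simp add: out_part_def map_key.rep_eq)

lemma weight_superset:
  assumes "finite F" "Poly_Mapping.keys \<theta> \<subseteq> F"
  shows "weight \<theta> U = (\<Sum>z \<in> U \<inter> F. Poly_Mapping.lookup \<theta> z)"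
  unfolding weight_def
  by (rule sum.mono_neutral_left) (use assms in \<open>auto simp: in_keys_iff\<close>)

lemma weight_add: "weight (\<theta> + \<eta>) U = weight \<theta> U + weight \<eta> U"
proof -
  let ?F = "Poly_Mapping.keys \<theta> \<union> Poly_Mapping.keys \<eta>"
  have "weight (\<theta> + \<eta>) U = (\<Sum>z \<in> U \<inter> ?F. Poly_Mapping.lookup (\<theta> + \<eta>) z)"
    by (rule weight_superset) (use Poly_Mapping.keys_add[of \<theta> \<eta>] in auto)
  moreover have "weight \<theta> U = (\<Sum>z \<in> U \<inter> ?F. Poly_Mapping.lookup \<theta> z)"
    by (rule weight_superset) auto
  moreover have "weight \<eta> U = (\<Sum>z \<in> U \<inter> ?F. Poly_Mapping.lookup \<eta> z)"
    by (rule weight_superset) auto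
  ultimately show ?thesis
    by (simp add: lookup_add sum.distrib)
qed

lemma weight_scale: "weight (scale c \<theta>) U = c * weight \<theta> U"
proof -
  have "weight (scale c \<theta>) U = (\<Sum>z \<in> U \<inter> Poly_Mapping.keys \<theta>. Poly_Mapping.lookup (scale c \<theta>) z)"
    by (rule weight_superset) (auto simp: in_keys_iff)
  then show ?thesis
    by (simp add: weight_def sum_distrib_left)
qed

lemma weight_zero [simp]: "weight 0 U = 0"
  by (simp add: weight_def)

lemma OP_add: "\<theta> \<in> OP Z \<Longrightarrow> \<eta> \<in> OP Z \<Longrightarrow> \<theta> + \<eta> \<in> OP Z"
  using Poly_Mapping.keys_add[of \<theta> \<eta>] by (auto simp: OP_def)

lemma OP_zero [simp]: "0 \<in> OP Z"
  by (simp add: OP_def)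

lemma OP_scale: "\<theta> \<in> OP Z \<Longrightarrow> scale c \<theta> \<in> OP Z"
  by (auto simp: OP_def in_keys_iff subset_iff) (metis mult_zero_right)

lemma hh_le_add:
  "(\<theta>, \<theta>') \<in> hh_le Z le \<Longrightarrow> (\<eta>, \<eta>') \<in> hh_le Z le \<Longrightarrow> (\<theta> + \<eta>, \<theta>' + \<eta>') \<in> hh_le Z le"
  by (auto simp: hh_le_def OP_add weight_add intro: add_mono)

lemma hh_le_scale: "(\<theta>, \<theta>') \<in> hh_le Z le \<Longrightarrow> (scale c \<theta>, scale c \<theta>') \<in> hh_le Z le"
  by (auto simp: hh_le_def OP_scale weight_scale intro: mult_left_mono zero_bot)

lemma hh_le_sum:
  "(\<And>x. x \<in> X \<Longrightarrow> (\<theta> x, \<eta> x) \<in> hh_le Z le) \<Longrightarrow> (\<Sum>x\<in>X. \<theta> x, \<Sum>x\<in>X. \<eta> x) \<in> hh_le Z le"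
proof (induction X rule: infinite_finite_induct)
  case (insert x X)
  then show ?case by (simp add: hh_le_add)
qed (auto simp: hh_le_def)

lemma trans_hh_le: "trans (hh_le Z le)"
proof (rule transI)
  fix \<theta> \<eta> \<zeta>
  assume le: "(\<theta>, \<eta>) \<in> hh_le Z le" "(\<eta>, \<zeta>) \<in> hh_le Z le"
  have "weight \<theta> U \<le> weight \<zeta> U" if "upclosed Z le U" for U
    using le that order_trans[of "weight \<theta> U" "weight \<eta> U" "weight \<zeta> U"]
    by (simp add: hh_le_def)
  then show "(\<theta>, \<zeta>) \<in> hh_le Z le"
    using le by (simp add: hh_le_def)
qed

lemma equiv_hh_eq: "equiv (OP Z) (hh_eq Z le)"
proof (rule equivI)
  show "hh_eq Z le \<subseteq> OP Z \<times> OP Z" by (auto simp: hh_eq_def hh_le_def)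
  show "refl_on (OP Z) (hh_eq Z le)" by (auto simp: refl_on_def hh_eq_def hh_le_def)
  show "sym (hh_eq Z le)" by (auto simp: sym_def hh_eq_def)
  show "trans (hh_eq Z le)"
    unfolding hh_eq_def by (intro trans_Int) (auto intro!: transI dest: transD[OF trans_hh_le])
qed

lemma hh_class_eq: "(\<theta>, \<eta>) \<in> hh_eq Z le \<Longrightarrow> hh_eq Z le `` {\<theta>} = hh_eq Z le `` {\<eta>}"
  by (rule equiv_class_eq[OF equiv_hh_eq])

lemma hh_class_self: "\<theta> \<in> OP Z \<Longrightarrow> \<theta> \<in> hh_eq Z le `` {\<theta>}"
  by (rule equiv_class_self[OF equiv_hh_eq])

lemma class_scale_class:
  assumes "\<theta> \<in> OP Z"
  shows "class_scale Z le c (hh_eq Z le `` {\<theta>}) = hh_eq Z le `` {scale c \<theta>}"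
proof -
  have "hh_eq Z le `` {scale c \<theta>'} = hh_eq Z le `` {scale c \<theta>}" if "\<theta>' \<in> hh_eq Z le `` {\<theta>}" for \<theta>'
    by (rule hh_class_eq) (use that in \<open>auto simp: hh_eq_def hh_le_scale\<close>)
  then show ?thesis
    using hh_class_self[OF assms, of le] unfolding class_scale_def by blast
qed

lemma class_add_class:
  assumes "\<theta> \<in> OP Z" "\<eta> \<in> OP Z"
  shows "class_add Z le (hh_eq Z le `` {\<theta>}) (hh_eq Z le `` {\<eta>}) = hh_eq Z le `` {\<theta> + \<eta>}"
proof -
  have "hh_eq Z le `` {\<theta>' + \<eta>'} = hh_eq Z le `` {\<theta> + \<eta>}"
    if "\<theta>' \<in> hh_eq Z le `` {\<theta>}" "\<eta>' \<in> hh_eq Z le `` {\<eta>}" for \<theta>' \<eta>'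
    by (rule hh_class_eq) (use that in \<open>auto simp: hh_eq_def hh_le_add\<close>)
  then show ?thesis
    using hh_class_self[OF assms(1), of le] hh_class_self[OF assms(2), of le]
    unfolding class_add_def by blast
qed

lemma class_sum_class:
  assumes "\<And>x. x \<in> X \<Longrightarrow> \<theta> x \<in> OP Z"
  shows "class_sum Z le (\<lambda>x. hh_eq Z le `` {\<theta> x}) X = hh_eq Z le `` {\<Sum>x\<in>X. \<theta> x}"
proof -
  have "hh_eq Z le `` {\<Sum>x\<in>X. \<theta>' x} = hh_eq Z le `` {\<Sum>x\<in>X. \<theta> x}"
    if "\<theta>' \<in> (\<Pi> x\<in>X. hh_eq Z le `` {\<theta> x})" for \<theta>'
    by (rule hh_class_eq) (use that in \<open>auto simp: hh_eq_def Pi_iff intro!: hh_le_sum\<close>)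
  moreover have "\<theta> \<in> (\<Pi> x\<in>X. hh_eq Z le `` {\<theta> x})"
    using hh_class_self[OF assms] by auto
  ultimately show ?thesis
    unfolding class_sum_def by blast
qed

lemma class_le_class:
  assumes "\<theta> \<in> OP Z" "\<eta> \<in> OP Z"
  shows "class_le Z le (hh_eq Z le `` {\<theta>}) (hh_eq Z le `` {\<eta>}) \<longleftrightarrow> (\<theta>, \<eta>) \<in> hh_le Z le"
proof
  assume "class_le Z le (hh_eq Z le `` {\<theta>}) (hh_eq Z le `` {\<eta>})"
  then obtain \<theta>' \<eta>' where "(\<theta>, \<theta>') \<in> hh_le Z le" "(\<theta>', \<eta>') \<in> hh_le Z le" "(\<eta>', \<eta>) \<in> hh_le Z le"
    by (auto simp: class_le_def hh_eq_def)
  then show "(\<theta>, \<eta>) \<in> hh_le Z le"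
    using trans_hh_le by (blast dest: transD)
next
  assume "(\<theta>, \<eta>) \<in> hh_le Z le"
  then show "class_le Z le (hh_eq Z le `` {\<theta>}) (hh_eq Z le `` {\<eta>})"
    unfolding class_le_def using hh_class_self assms by blast
qed

lemma SP_class_subset:
  assumes "partial_order_on Z le" "\<theta> \<in> SP Z"
  shows "hh_eq Z le `` {\<theta>} \<subseteq> SP Z"
proof -
  have "upclosed Z le Z"
    using partial_order_onD(4)[OF assms(1)] by (auto simp: upclosed_def)
  then show ?thesis
    using assms(2) order_trans[of "weight _ Z" "weight \<theta> Z" 1]
    by (simp add: SP_def hh_eq_def hh_le_def subset_iff)
qed

lemma sum_le_simps [simp]:
  "(Inl a, Inl b) \<in> sum_le r s \<longleftrightarrow> (a, b) \<in> r"
  "(Inr c, Inr d) \<in> sum_le r s \<longleftrightarrow> (c, d) \<in> s"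
  "(Inl a, Inr d) \<notin> sum_le r s"
  "(Inr c, Inl b) \<notin> sum_le r s"
  by (auto simp: sum_le_def)

lemma partial_order_sum_le:
  assumes "partial_order_on X r" "partial_order_on Y s"
  shows "partial_order_on (X <+> Y) (sum_le r s)"
proof -
  note X = partial_order_onD[OF assms(1)] and Y = partial_order_onD[OF assms(2)]
  have "sum_le r s \<subseteq> (X <+> Y) \<times> (X <+> Y)"
    using X(4) Y(4) by (auto simp: sum_le_def)
  moreover have "refl_on (X <+> Y) (sum_le r s)"
    using X(1) Y(1) by (auto simp: refl_on_def)
  moreover have "trans (sum_le r s)"
  proof (rule transI)
    fix a b c assume "(a, b) \<in> sum_le r s" "(b, c) \<in> sum_le r s"
    then show "(a, c) \<in> sum_le r s"
      by (cases a; cases b; cases c) (auto dest: transD[OF X(2)] transD[OF Y(2)])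
  qed
  moreover have "antisym (sum_le r s)"
  proof (rule antisymI)
    fix a b assume "(a, b) \<in> sum_le r s" "(b, a) \<in> sum_le r s"
    then show "a = b"
      by (cases a; cases b) (auto dest: antisymD[OF X(3)] antisymD[OF Y(3)])
  qed
  ultimately show ?thesis
    by (simp add: partial_order_on_def preorder_on_def)
qed

lemma weight_Inl:
  assumes "U = {Inl x}"
  shows "weight \<theta> U = Poly_Mapping.lookup \<theta> (Inl x)"
  using assms weight_superset[of "insert (Inl x) (Poly_Mapping.keys \<theta>)" \<theta> U] by auto

lemma weight_Inr:
  "weight \<theta> (Inr ` U) = weight (Poly_Mapping.map_key Inr \<theta>) U"
proof -
  have "Inr ` U \<inter> Poly_Mapping.keys \<theta> = Inr ` (U \<inter> Poly_Mapping.keys (Poly_Mapping.map_key Inr \<theta>))"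
    by (auto simp: keys_map_key)
  then show ?thesis
    by (simp add: weight_def sum.reindex map_key.rep_eq)
qed

text \<open>The coefficients and the output classes do not depend on the chosen representatives.\<close>

lemma coefficients_independent:
  assumes eq: "(\<theta>, \<eta>) \<in> hh_eq (X <+> Y) (sum_le (Id_on X) le)"
  shows "x \<in> X \<Longrightarrow> Poly_Mapping.lookup \<theta> (Inl x) = Poly_Mapping.lookup \<eta> (Inl x)"
    and "(Poly_Mapping.map_key Inr \<theta>, Poly_Mapping.map_key Inr \<eta>) \<in> hh_eq Y le"
proof -
  assume "x \<in> X"
  then have "upclosed (X <+> Y) (sum_le (Id_on X) le) {Inl x}"
    by (auto simp: upclosed_def sum_le_def Id_on_def)
  then have "weight \<theta> {Inl x} = weight \<eta> {Inl x}"
    using eq by (auto simp: hh_eq_def hh_le_def intro: order_antisym)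
  then show "Poly_Mapping.lookup \<theta> (Inl x) = Poly_Mapping.lookup \<eta> (Inl x)"
    by (simp add: weight_Inl)
next
  have "upclosed (X <+> Y) (sum_le (Id_on X) le) (Inr ` U)" if "upclosed Y le U" for U
    using that by (auto simp: upclosed_def sum_le_def)
  then have "weight \<theta> (Inr ` U) = weight \<eta> (Inr ` U)" if "upclosed Y le U" for U
    using eq that by (auto simp: hh_eq_def hh_le_def intro: order_antisym)
  moreover have "Poly_Mapping.map_key Inr \<theta> \<in> OP Y" "Poly_Mapping.map_key Inr \<eta> \<in> OP Y"
    using eq by (auto simp: hh_eq_def hh_le_def OP_def keys_map_key)
  ultimately show "(Poly_Mapping.map_key Inr \<theta>, Poly_Mapping.map_key Inr \<eta>) \<in> hh_eq Y le"
    by (auto simp: hh_eq_def hh_le_def weight_Inr)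
qed

end

(* The order on classes compares weights of upwards-closed sets, and weights are finite sums of
   values. So it suffices to run the Kleene iteration from 0 pointwise on representatives: all
   iterates are supported in the finite union of the supports of the out parts, so their pointwise
   least upper bound is finitely supported, and omega-continuity makes it a fixed point. Every
   iterate has total weight at most 1 and lies below every solution, and both properties pass to
   the least upper bound. *)

theory Submission
  imports Defs
begin

section \<open>Least upper bounds of chains\<close>

lemma isLub_UNIV_iff:
  fixes a :: "'a::order"
  shows "isLub UNIV S a \<longleftrightarrow> (\<forall>s\<in>S. s \<le> a) \<and> (\<forall>b. (\<forall>s\<in>S. s \<le> b) \<longrightarrow> a \<le> b)"
  by (auto simp: isLub_def leastP_def isUb_def setle_def setge_def)

lemma isLub_order_unique: "isLub UNIV S a \<Longrightarrow> isLub UNIV S b \<Longrightarrow> a = (b::'a::order)"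
  by (auto simp: isLub_UNIV_iff intro: order_antisym)

lemma isLub_const: "isLub UNIV (range (\<lambda>_::nat. c)) (c::'a::order)"
  by (auto simp: isLub_UNIV_iff)

text \<open>Dropping the first term of an increasing chain leaves its upper bounds unchanged. This
  shift relates the limit of the iterates to the limit of their images under the step map.\<close>

lemma isLub_Suc:
  fixes r :: "nat \<Rightarrow> 'a::order"
  assumes "mono r" "isLub UNIV (range r) a"
  shows "isLub UNIV (range (\<lambda>n. r (Suc n))) a"
proof -
  have "(\<forall>n. r n \<le> b) \<longleftrightarrow> (\<forall>n. r (Suc n) \<le> b)" for b
    using order_trans[OF monoD[OF assms(1) le_SucI[OF order_refl]]] by blast
  with assms(2) show ?thesis
    by (auto simp: isLub_UNIV_iff)
qed

lemma omega_continuous_isLub_sum: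
  fixes r :: "'i \<Rightarrow> nat \<Rightarrow> 'p::bot_ordered_semiring"
  assumes "omega_continuous TYPE('p)"
    and "\<And>i. i \<in> I \<Longrightarrow> mono (r i)" "\<And>i. i \<in> I \<Longrightarrow> isLub UNIV (range (r i)) (a i)"
  shows "isLub UNIV (range (\<lambda>n. \<Sum>i\<in>I. r i n)) (\<Sum>i\<in>I. a i)"
  using assms(2,3)
proof (induction I rule: infinite_finite_induct)
  case (insert i I)
  \<comment> \<open>Continuity speaks of increasing chains only, so the partial sums must be
    increasing before it applies to them.\<close>
  moreover from insert.prems have "mono (\<lambda>n. \<Sum>i\<in>I. r i n)"
    by (auto intro!: monoI sum_mono dest: monoD)
  ultimately show ?case
    using assms(1) by (simp add: omega_continuous_def)
qed (simp_all add: isLub_UNIV_iff)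


section \<open>Chains of finitely supported functions\<close>

text \<open>The limit is taken on coefficients rather than in the heavier-higher preorder, so that
  one limit serves the weights of all sets \<open>U\<close> at once.\<close>

definition pointwise_lub ::
  "(nat \<Rightarrow> 'z \<Rightarrow>\<^sub>0 'p::bot_ordered_semiring) \<Rightarrow> ('z \<Rightarrow>\<^sub>0 'p) \<Rightarrow> bool" where
  "pointwise_lub \<tau> \<sigma> \<longleftrightarrow>
     (\<forall>z. isLub UNIV (range (\<lambda>n. Poly_Mapping.lookup (\<tau> n) z)) (Poly_Mapping.lookup \<sigma> z))"

text \<open>The common finite support \<open>F\<close> keeps the limit finitely supported: outside
  \<open>F\<close> every chain is constantly 0, hence so is its limit.\<close>

lemma pointwise_lub_exists:
  fixes \<tau> :: "nat \<Rightarrow> 'z \<Rightarrow>\<^sub>0 'p::bot_ordered_semiring"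
  assumes "omega_continuous TYPE('p)" "\<And>z. mono (\<lambda>n. Poly_Mapping.lookup (\<tau> n) z)"
    and "finite F" "\<And>n. Poly_Mapping.keys (\<tau> n) \<subseteq> F"
  obtains \<sigma> where "pointwise_lub \<tau> \<sigma>" "Poly_Mapping.keys \<sigma> \<subseteq> F"
proof -
  have "\<exists>a. isLub UNIV (range (\<lambda>n. Poly_Mapping.lookup (\<tau> n) z)) a" for z
    using assms(1,2) unfolding omega_continuous_def by blast
  then obtain f where f: "\<And>z. isLub UNIV (range (\<lambda>n. Poly_Mapping.lookup (\<tau> n) z)) (f z)"
    by metis
  have "f z = 0" if "z \<notin> F" for z
  proof -
    have "Poly_Mapping.lookup (\<tau> n) z = 0" for n
      using that assms(4)[of n] by (auto simp: in_keys_iff)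
    then show ?thesis
      using isLub_order_unique[OF f[of z], of 0] by (simp add: isLub_UNIV_iff)
  qed
  then have F: "{z. f z \<noteq> 0} \<subseteq> F"
    by auto
  then have "Poly_Mapping.lookup (Abs_poly_mapping f) = f"
    using assms(3) by (auto intro: Abs_poly_mapping_inverse finite_subset)
  then show ?thesis
    using f F by (intro that[of "Abs_poly_mapping f"]) (auto simp: pointwise_lub_def in_keys_iff)
qed

text \<open>With a common support \<open>F\<close>, every weight is a sum over the same finite index
  set \<open>U \<inter> F\<close>, so continuity of finite sums applies.\<close>

lemma isLub_weight:
  fixes \<tau> :: "nat \<Rightarrow> 'z \<Rightarrow>\<^sub>0 'p::bot_ordered_semiring"
  assumes "omega_continuous TYPE('p)" "\<And>z. mono (\<lambda>n. Poly_Mapping.lookup (\<tau> n) z)"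
    and "finite F" "\<And>n. Poly_Mapping.keys (\<tau> n) \<subseteq> F" "Poly_Mapping.keys \<sigma> \<subseteq> F"
    and "pointwise_lub \<tau> \<sigma>"
  shows "isLub UNIV (range (\<lambda>n. weight (\<tau> n) U)) (weight \<sigma> U)"
  using omega_continuous_isLub_sum[OF assms(1), of "U \<inter> F" "\<lambda>z n. Poly_Mapping.lookup (\<tau> n) z"]
    assms(2,6)
  by (simp add: weight_superset[OF assms(3)] assms(4,5) pointwise_lub_def)

lemma weight_sum: "weight (\<Sum>x\<in>X. \<theta> x) U = (\<Sum>x\<in>X. weight (\<theta> x) U)"
  by (induction X rule: infinite_finite_induct) (auto simp: weight_add)

lemma OP_sum: "(\<And>x. x \<in> X \<Longrightarrow> \<theta> x \<in> OP Z) \<Longrightarrow> (\<Sum>x\<in>X. \<theta> x) \<in> OP Z"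
  by (induction X rule: infinite_finite_induct) (auto simp: OP_add)

lemma lookup_sum_poly_mapping:
  "Poly_Mapping.lookup (\<Sum>x\<in>X. \<theta> x) z = (\<Sum>x\<in>X. Poly_Mapping.lookup (\<theta> x) z)"
  by (induction X rule: infinite_finite_induct) (auto simp: lookup_add)


section \<open>Kleene iteration\<close>

text \<open>The right-hand side of the system, on representatives instead of classes.\<close>

definition affine_step ::
  "'x set \<Rightarrow> ('x \<Rightarrow> 'x \<Rightarrow> 'p::bot_ordered_semiring) \<Rightarrow> ('x \<Rightarrow> 'y \<Rightarrow>\<^sub>0 'p)
     \<Rightarrow> ('x \<Rightarrow> 'y \<Rightarrow>\<^sub>0 'p) \<Rightarrow> 'x \<Rightarrow> 'y \<Rightarrow>\<^sub>0 'p" where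
  "affine_step X a \<theta> \<sigma> x = (\<Sum>x'\<in>X. scale (a x x') (\<sigma> x')) + \<theta> x"

definition kleene ::
  "'x set \<Rightarrow> ('x \<Rightarrow> 'x \<Rightarrow> 'p::bot_ordered_semiring) \<Rightarrow> ('x \<Rightarrow> 'y \<Rightarrow>\<^sub>0 'p)
     \<Rightarrow> nat \<Rightarrow> 'x \<Rightarrow> 'y \<Rightarrow>\<^sub>0 'p" where
  "kleene X a \<theta> n = (affine_step X a \<theta> ^^ n) (\<lambda>_. 0)"

lemma kleene_0 [simp]: "kleene X a \<theta> 0 x = 0"
  by (simp add: kleene_def)

lemma kleene_Suc: "kleene X a \<theta> (Suc n) = affine_step X a \<theta> (kleene X a \<theta> n)"
  by (simp add: kleene_def)

lemma lookup_affine_step: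
  "Poly_Mapping.lookup (affine_step X a \<theta> \<sigma> x) y =
     (\<Sum>x'\<in>X. a x x' * Poly_Mapping.lookup (\<sigma> x') y) + Poly_Mapping.lookup (\<theta> x) y"
  by (simp add: affine_step_def lookup_add lookup_sum_poly_mapping)

lemma weight_affine_step:
  "weight (affine_step X a \<theta> \<sigma> x) U = (\<Sum>x'\<in>X. a x x' * weight (\<sigma> x') U) + weight (\<theta> x) U"
  by (simp add: affine_step_def weight_add weight_sum weight_scale)

lemma affine_step_OP:
  assumes "\<And>x. x \<in> X \<Longrightarrow> \<sigma> x \<in> OP Z" "\<theta> x \<in> OP Z"
  shows "affine_step X a \<theta> \<sigma> x \<in> OP Z"
  using assms by (auto simp: affine_step_def intro!: OP_add OP_sum OP_scale)

lemma kleene_mono: "mono (\<lambda>n. Poly_Mapping.lookup (kleene X a \<theta> n x) y)"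
proof (rule mono_iff_le_Suc[THEN iffD2], rule allI)
  fix n
  show "Poly_Mapping.lookup (kleene X a \<theta> n x) y \<le> Poly_Mapping.lookup (kleene X a \<theta> (Suc n) x) y"
  proof (induction n arbitrary: x)
    case (Suc n)
    have "Poly_Mapping.lookup (affine_step X a \<theta> (kleene X a \<theta> n) x) y
        \<le> Poly_Mapping.lookup (affine_step X a \<theta> (kleene X a \<theta> (Suc n)) x) y"
      using Suc.IH unfolding lookup_affine_step
      by (intro add_mono sum_mono mult_left_mono zero_bot order_refl)
    then show ?case
      by (simp only: kleene_Suc)
  qed (simp add: zero_bot)
qed

lemma kleene_OP:
  assumes "\<And>x. x \<in> X \<Longrightarrow> \<theta> x \<in> OP Z" "x \<in> X"
  shows "kleene X a \<theta> n x \<in> OP Z"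
  using assms(2) by (induction n arbitrary: x) (auto simp: kleene_Suc assms(1) intro!: affine_step_OP)

text \<open>Park-style induction: for a fixed \<open>U\<close> the weights of the iterates follow a
  scalar affine system that starts at 0 and so never climbs past a \<open>w\<close> which the system
  does not increase.\<close>

lemma kleene_weight_le:
  assumes "\<And>x. x \<in> X \<Longrightarrow> (\<Sum>x'\<in>X. a x x' * w x') + weight (\<theta> x) U \<le> w x" "x \<in> X"
  shows "weight (kleene X a \<theta> n x) U \<le> w x"
  using assms(2)
proof (induction n arbitrary: x)
  case (Suc n)
  then have "weight (kleene X a \<theta> (Suc n) x) U \<le> (\<Sum>x'\<in>X. a x x' * w x') + weight (\<theta> x) U"
    unfolding kleene_Suc weight_affine_step
    by (intro add_mono sum_mono mult_left_mono zero_bot order_refl)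
  also have "\<dots> \<le> w x"
    using assms(1) Suc.prems .
  finally show ?case .
qed (simp add: zero_bot)

text \<open>Leastness is stated through weights because a solution is a fixed point only up to
  \<open>hh_eq\<close>: its weights on upwards-closed sets satisfy the equations, but its
  representatives need not dominate \<open>\<sigma>\<close> pointwise.\<close>

lemma affine_step_least_fixpoint:
  fixes a :: "'x \<Rightarrow> 'x \<Rightarrow> 'p::bot_ordered_semiring" and \<theta> :: "'x \<Rightarrow> 'y \<Rightarrow>\<^sub>0 'p"
  assumes cont: "omega_continuous TYPE('p)" and "finite X" and \<theta>: "\<And>x. x \<in> X \<Longrightarrow> \<theta> x \<in> OP Y"
  obtains \<sigma> where "\<And>x. x \<in> X \<Longrightarrow> \<sigma> x \<in> OP Y" "\<And>x. x \<in> X \<Longrightarrow> affine_step X a \<theta> \<sigma> x = \<sigma> x"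
    "\<And>w U x. (\<And>x. x \<in> X \<Longrightarrow> (\<Sum>x'\<in>X. a x x' * w x') + weight (\<theta> x) U \<le> w x) \<Longrightarrow> x \<in> X
       \<Longrightarrow> weight (\<sigma> x) U \<le> w x"
proof -
  let ?k = "kleene X a \<theta>"
  let ?F = "\<Union>x\<in>X. Poly_Mapping.keys (\<theta> x)"
  have F: "finite ?F" "?F \<subseteq> Y"
    using \<open>finite X\<close> \<theta> by (auto simp: OP_def)
  \<comment> \<open>\<open>kleene_OP\<close> is used with \<open>?F\<close> in place of
    \<open>Y\<close>, which bounds the supports of all iterates by one finite set.\<close>
  have keys: "Poly_Mapping.keys (?k n x) \<subseteq> ?F" if "x \<in> X" for n x
    using kleene_OP[of X \<theta> ?F x a n] that by (auto simp: OP_def)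
  have "\<exists>\<sigma>. pointwise_lub (\<lambda>n. ?k n x) \<sigma> \<and> Poly_Mapping.keys \<sigma> \<subseteq> ?F" if "x \<in> X" for x
    using pointwise_lub_exists[OF cont kleene_mono F(1) keys[OF that]] by blast
  then obtain \<sigma> where lub: "\<And>x. x \<in> X \<Longrightarrow> pointwise_lub (\<lambda>n. ?k n x) (\<sigma> x)"
    and keys_\<sigma>: "\<And>x. x \<in> X \<Longrightarrow> Poly_Mapping.keys (\<sigma> x) \<subseteq> ?F"
    by metis
  show ?thesis
  proof (rule that[of \<sigma>])
    show "\<sigma> x \<in> OP Y" if "x \<in> X" for x
      using keys_\<sigma>[OF that] F(2) by (simp add: OP_def)
    show "affine_step X a \<theta> \<sigma> x = \<sigma> x" if "x \<in> X" for x
    proof (rule poly_mapping_eqI)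
      fix y
      let ?v = "\<lambda>x n. Poly_Mapping.lookup (?k n x) y"
      have v: "isLub UNIV (range (?v x')) (Poly_Mapping.lookup (\<sigma> x') y)" if "x' \<in> X" for x'
        using lub[OF that] by (simp add: pointwise_lub_def)
      have c: "mono r \<Longrightarrow> mono s \<Longrightarrow> isLub UNIV (range r) b \<Longrightarrow> isLub UNIV (range s) d \<Longrightarrow>
          isLub UNIV (range (\<lambda>n. r n + s n)) (b + d) \<and> isLub UNIV (range (\<lambda>n. r n * s n)) (b * d)"
        for r s :: "nat \<Rightarrow> 'p" and b d
        using cont unfolding omega_continuous_def by blast
      have const: "mono (\<lambda>_::nat. p)" for p :: 'p
        by (simp add: monoI)
      have mono: "mono (\<lambda>n. a x x' * ?v x' n)" for x'
        by (intro monoI mult_left_mono zero_bot monoD[OF kleene_mono])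
      \<comment> \<open>A constant chain turns joint continuity of the product into continuity of
        left multiplication by \<open>a x x'\<close>.\<close>
      have "isLub UNIV (range (\<lambda>n. a x x' * ?v x' n)) (a x x' * Poly_Mapping.lookup (\<sigma> x') y)"
        if "x' \<in> X" for x'
        using c[OF const kleene_mono isLub_const v[OF that]] by blast
      then have "isLub UNIV (range (\<lambda>n. \<Sum>x'\<in>X. a x x' * ?v x' n))
          (\<Sum>x'\<in>X. a x x' * Poly_Mapping.lookup (\<sigma> x') y)"
        using mono by (intro omega_continuous_isLub_sum[OF cont])
      moreover have "mono (\<lambda>n. \<Sum>x'\<in>X. a x x' * ?v x' n)"
        by (intro monoI sum_mono monoD[OF mono])
      ultimately have "isLub UNIV (range (\<lambda>n. ?v x (Suc n)))
          (Poly_Mapping.lookup (affine_step X a \<theta> \<sigma> x) y)"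
        unfolding kleene_Suc lookup_affine_step using c[OF _ const _ isLub_const] by blast
      \<comment> \<open>Both sides are least upper bounds of the same chain, the iterates shifted by
        one.\<close>
      then show "Poly_Mapping.lookup (affine_step X a \<theta> \<sigma> x) y = Poly_Mapping.lookup (\<sigma> x) y"
        by (rule isLub_order_unique) (rule isLub_Suc[OF kleene_mono v[OF that]])
    qed
    fix w U x
    assume w: "\<And>x. x \<in> X \<Longrightarrow> (\<Sum>x'\<in>X. a x x' * w x') + weight (\<theta> x) U \<le> w x" and "x \<in> X"
    have "isLub UNIV (range (\<lambda>n. weight (?k n x) U)) (weight (\<sigma> x) U)"
      using isLub_weight[OF cont kleene_mono F(1) keys keys_\<sigma> lub] \<open>x \<in> X\<close> by blast
    moreover have "weight (?k n x) U \<le> w x" for n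
      using kleene_weight_le[of X a w \<theta> U, OF w \<open>x \<in> X\<close>] .
    ultimately show "weight (\<sigma> x) U \<le> w x"
      by (auto simp: isLub_UNIV_iff)
  qed
qed


section \<open>Solutions\<close>

lemma hh_eq_iff:
  "(\<theta>, \<eta>) \<in> hh_eq Z le \<longleftrightarrow>
     \<theta> \<in> OP Z \<and> \<eta> \<in> OP Z \<and> (\<forall>U. upclosed Z le U \<longrightarrow> weight \<theta> U = weight \<eta> U)"
  by (auto simp: hh_eq_def hh_le_def order_eq_iff)

text \<open>\<open>SP Z\<close> is a union of equivalence classes, so whichever member
  \<open>rep\<close> picks lies in it.\<close>

lemma rep_SP:
  assumes "partial_order_on Z le" "A \<in> SPbar Z le"
  shows "rep A \<in> SP Z"
proof -
  obtain \<theta> where \<theta>: "\<theta> \<in> SP Z" "A = hh_eq Z le `` {\<theta>}"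
    using assms(2) by (auto simp: SPbar_def quotient_def)
  then have "\<theta> \<in> A"
    using hh_class_self by (auto simp: SP_def)
  then have "rep A \<in> A"
    unfolding rep_def by (rule someI)
  then show ?thesis
    using SP_class_subset[OF assms(1) \<theta>(1)] \<theta>(2) by auto
qed

lemma weight_Plus:
  assumes "finite X"
  shows "weight \<theta> (X <+> Y) =
    (\<Sum>x\<in>X. Poly_Mapping.lookup \<theta> (Inl x)) + weight (Poly_Mapping.map_key Inr \<theta>) Y"
proof -
  \<comment> \<open>The support is enlarged by the left copies of \<open>X\<close>, so that the
    first sum runs over all of \<open>X\<close>, zero coefficients included.\<close>
  let ?F = "Poly_Mapping.keys \<theta> \<union> Inl ` X"
  have "weight \<theta> (X <+> Y) = (\<Sum>z \<in> (X <+> Y) \<inter> ?F. Poly_Mapping.lookup \<theta> z)"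
    using assms by (intro weight_superset) auto
  also have "(X <+> Y) \<inter> ?F = Inl ` X \<union> (Inr ` Y \<inter> Poly_Mapping.keys \<theta>)"
    by auto
  also have "(\<Sum>z\<in>\<dots>. Poly_Mapping.lookup \<theta> z) =
      (\<Sum>z\<in>Inl ` X. Poly_Mapping.lookup \<theta> z) + weight \<theta> (Inr ` Y)"
    unfolding weight_def using assms by (intro sum.union_disjoint) auto
  finally show ?thesis
    by (simp add: weight_Inr sum.reindex)
qed

text \<open>The inequality is the bound on the total weight of the representative, split along the
  disjoint union. It makes the constant 1 an upper bound that the system of total weights does not
  increase.\<close>

lemma unguarded_system_parts:
  assumes "finite X" "partial_order_on Y le" "unguarded_system X Y le \<gamma>" "x \<in> X"
  shows "out_part \<gamma> x \<in> OP Y" "(\<Sum>x'\<in>X. coeff \<gamma> x x') + weight (out_part \<gamma> x) Y \<le> 1"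
proof -
  have "partial_order_on X (Id_on X)"
    by (auto simp: partial_order_on_def preorder_on_def refl_on_def trans_def antisym_def)
  then have "rep (\<gamma> x) \<in> SP (X <+> Y)"
    using assms(2-4)
    by (intro rep_SP[OF partial_order_sum_le]) (auto simp: unguarded_system_def)
  then show "out_part \<gamma> x \<in> OP Y" "(\<Sum>x'\<in>X. coeff \<gamma> x x') + weight (out_part \<gamma> x) Y \<le> 1"
    by (auto simp: SP_def OP_def out_part_def coeff_def keys_map_key weight_Plus[OF assms(1)])
qed

text \<open>All class operations can be computed on representatives, so being a solution becomes
  being a fixed point up to \<open>hh_eq\<close>.\<close>

lemma solution_classes_iff:
  assumes "\<And>x. x \<in> X \<Longrightarrow> out_part \<gamma> x \<in> OP Y"
    and "\<And>x. x \<in> X \<Longrightarrow> \<sigma> x \<in> SP Y" "\<And>x. x \<in> X \<Longrightarrow> \<psi> x = hh_eq Y le `` {\<sigma> x}"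
  shows "solution X Y le \<gamma> \<psi> \<longleftrightarrow>
    (\<forall>x\<in>X. (\<sigma> x, affine_step X (coeff \<gamma>) (out_part \<gamma>) \<sigma> x) \<in> hh_eq Y le)"
proof -
  have OP: "\<sigma> x \<in> OP Y" if "x \<in> X" for x
    using assms(2)[OF that] by (simp add: SP_def)
  have "class_add Y le (class_sum Y le (\<lambda>x'. class_scale Y le (coeff \<gamma> x x') (\<psi> x')) X)
          (hh_eq Y le `` {out_part \<gamma> x})
      = hh_eq Y le `` {affine_step X (coeff \<gamma>) (out_part \<gamma>) \<sigma> x}" if "x \<in> X" for x
  proof -
    have "class_sum Y le (\<lambda>x'. class_scale Y le (coeff \<gamma> x x') (\<psi> x')) X
        = class_sum Y le (\<lambda>x'. hh_eq Y le `` {scale (coeff \<gamma> x x') (\<sigma> x')}) X"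
      \<comment> \<open>The values of \<open>\<psi>\<close> are described on \<open>X\<close> only;
        unfolding \<open>Pi\<close> exposes the membership condition under which they may be
        rewritten.\<close>
      by (simp add: class_sum_def Pi_def assms(3) class_scale_class OP)
    also have "\<dots> = hh_eq Y le `` {\<Sum>x'\<in>X. scale (coeff \<gamma> x x') (\<sigma> x')}"
      by (intro class_sum_class OP_scale OP)
    finally show ?thesis
      using that by (simp add: class_add_class OP_sum OP_scale OP assms(1) affine_step_def)
  qed
  moreover have "\<psi> \<in> X \<rightarrow> SPbar Y le"
    by (simp add: Pi_iff SPbar_def assms(2,3) quotientI)
  moreover have "affine_step X (coeff \<gamma>) (out_part \<gamma>) \<sigma> x \<in> OP Y" if "x \<in> X" for x
    using OP assms(1) that by (intro affine_step_OP)
  ultimately show ?thesis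
    using OP by (auto simp: solution_def assms(3) eq_equiv_class_iff[OF equiv_hh_eq])
qed

theorem theorem20:
  fixes X :: "'x set" and Y :: "'y set" and le :: "'y rel"
    and \<gamma> :: "'x \<Rightarrow> ('x + 'y \<Rightarrow>\<^sub>0 'p::bot_ordered_semiring) set"
  assumes "cancellative TYPE('p) \<and> difference_ordered TYPE('p) \<or> add_idempotent TYPE('p)"
    and "omega_continuous TYPE('p)"
    and "finite X"
    and "partial_order_on Y le"
    and "unguarded_system X Y le \<gamma>"
  shows "\<exists>\<gamma>_dagger. solution X Y le \<gamma> \<gamma>_dagger \<and>
           (\<forall>\<psi>. solution X Y le \<gamma> \<psi> \<longrightarrow> (\<forall>x\<in>X. class_le Y le (\<gamma>_dagger x) (\<psi> x)))"
proof -
  note parts = unguarded_system_parts[OF assms(3-5)]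
  let ?step = "affine_step X (coeff \<gamma>) (out_part \<gamma>)"
  obtain \<sigma> where OP: "\<And>x. x \<in> X \<Longrightarrow> \<sigma> x \<in> OP Y" and fixpoint: "\<And>x. x \<in> X \<Longrightarrow> ?step \<sigma> x = \<sigma> x"
    and least: "\<And>w U x. (\<And>x. x \<in> X \<Longrightarrow>
          (\<Sum>x'\<in>X. coeff \<gamma> x x' * w x') + weight (out_part \<gamma> x) U \<le> w x) \<Longrightarrow> x \<in> X
        \<Longrightarrow> weight (\<sigma> x) U \<le> w x"
    using affine_step_least_fixpoint[where a = "coeff \<gamma>" and \<theta> = "out_part \<gamma>", OF assms(2,3) parts(1)]
    by blast
  \<comment> \<open>For \<open>w\<close> constantly 1, the condition on \<open>w\<close> is exactly
    the row inequality \<open>parts(2)\<close>.\<close>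
  have SP: "\<sigma> x \<in> SP Y" if "x \<in> X" for x
    using least[where w = "\<lambda>_. 1" and U = Y and x = x] OP parts(2) that by (simp add: SP_def)
  have "solution X Y le \<gamma> (\<lambda>x. hh_eq Y le `` {\<sigma> x})"
    using OP by (subst solution_classes_iff[where \<sigma> = \<sigma>, OF parts(1) SP])
      (auto simp: fixpoint hh_eq_iff)
  moreover have "class_le Y le (hh_eq Y le `` {\<sigma> x}) (\<psi> x)"
    if sol: "solution X Y le \<gamma> \<psi>" and "x \<in> X" for \<psi> x
  proof -
    have "\<psi> \<in> X \<rightarrow> SPbar Y le"
      using sol by (simp add: solution_def)
    then have "\<exists>\<eta>. \<eta> \<in> SP Y \<and> \<psi> x = hh_eq Y le `` {\<eta>}" if "x \<in> X" for x
      using that by (auto simp: SPbar_def quotient_def Pi_iff)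
    then obtain \<eta> where \<eta>: "\<And>x. x \<in> X \<Longrightarrow> \<eta> x \<in> SP Y" "\<And>x. x \<in> X \<Longrightarrow> \<psi> x = hh_eq Y le `` {\<eta> x}"
      by metis
    then have "(\<eta> x, ?step \<eta> x) \<in> hh_eq Y le" if "x \<in> X" for x
      using solution_classes_iff[of X \<gamma> Y \<eta> \<psi> le] parts(1) sol that by blast
    \<comment> \<open>On an upwards-closed \<open>U\<close>, equivalence up to \<open>hh_eq\<close>
      becomes equality of weights, so the weights of \<open>\<eta>\<close> satisfy the scalar
      equations and are an admissible \<open>w\<close>.\<close>
    then have "weight (\<sigma> x) U \<le> weight (\<eta> x) U" if "upclosed Y le U" for U
      using that \<open>x \<in> X\<close>
      by (intro least[where w = "\<lambda>x. weight (\<eta> x) U"])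
        (simp_all add: hh_eq_iff weight_affine_step)
    moreover have "\<eta> x \<in> OP Y"
      using \<eta>(1) \<open>x \<in> X\<close> by (simp add: SP_def)
    ultimately show ?thesis
      using OP \<open>x \<in> X\<close> by (simp add: \<eta>(2) class_le_class hh_le_def)
  qed
  ultimately show ?thesis
    by blast
qed

end
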